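(* For every integer $n\ge0$, \[ \mathrm{pc}_+^1(n)=2+\left(\lceil n/2\rceil-2\right)2^{\lceil n/2\rceil}. \]
   Context: A composition of $n$ is a finite sequence $\alpha=(\alpha_1,\ldots,\alpha_\ell)$ of positive integers with $\alpha_1+\cdots+\alpha_\ell=n$; the empty sequence ($\ell=0$) is the only composition of $0$. $\mathrm{pc}_+^1(n)$ is the number of compositions $\alpha=(\alpha_1,\ldots,\alpha_\ell)$ of $n$ such that $\#\{1\le i\le \ell/2:\alpha_i\ne\alpha_{\ell+1-i}\}=1$ and either $\ell$ is even, or $\ell$ is odd and the middle part $\alpha_{(\ell+1)/2}$ is even. *)

theory Defs
  imports Complex_Main
begin

definition compositions :: "nat \<Rightarrow> nat list set" where
  "compositions n = {\<alpha>. (\<forall>a \<in> set \<alpha>. 0 < a) \<and> sum_list \<alpha> = n}"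

text \<open>Parts are indexed from 1; only indices between 1 and the length are meaningful.\<close>

definition part :: "nat list \<Rightarrow> nat \<Rightarrow> nat" where
  "part \<alpha> i = \<alpha> ! (i - 1)"

definition asymmetric_indices :: "nat list \<Rightarrow> nat set" where
  "asymmetric_indices \<alpha> =
     {i. 1 \<le> i \<and> real i \<le> real (length \<alpha>) / 2 \<and> part \<alpha> i \<noteq> part \<alpha> (length \<alpha> + 1 - i)}"

definition pc_plus_1 :: "nat \<Rightarrow> nat" where
  "pc_plus_1 n = card {\<alpha> \<in> compositions n.
     card (asymmetric_indices \<alpha>) = 1 \<and>
     (even (length \<alpha>) \<or> odd (length \<alpha>) \<and> even (part \<alpha> ((length \<alpha> + 1) div 2)))}"

lemma finite_compositions: "finite (compositions n)"
proof (rule finite_subset)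
  have len: "(\<forall>a \<in> set \<alpha>. 0 < a) \<Longrightarrow> length \<alpha> \<le> sum_list \<alpha>" for \<alpha> :: "nat list"
    by (induction \<alpha>) (auto simp: Suc_le_eq)
  show "compositions n \<subseteq> {\<alpha>. set \<alpha> \<subseteq> {..n} \<and> length \<alpha> \<le> n}"
    using len by (auto simp: compositions_def member_le_sum_list)
  show "finite {\<alpha>. set \<alpha> \<subseteq> {..n} \<and> length \<alpha> \<le> n}"
    by (rule finite_lists_length_le) simp
qed

end

theory Submission
  imports Defs
begin

text \<open>
  The proof peels off the outermost pair of parts: a composition of length at least 2 has the
  form \<open>a # \<beta> @ [b]\<close>, the middle condition depends on \<open>\<beta>\<close> alone, and the number of asymmetric
  indices is that of \<open>\<beta>\<close>, plus one if \<open>a \<noteq> b\<close> (\<open>wrap_in_almost_palindromic_iff\<close>).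

  Let \<open>S n\<close> and \<open>T n\<close> be the numbers of compositions of \<open>n\<close> that satisfy the middle condition and
  have no, respectively exactly one, asymmetric index.  A palindrome with an even or missing middle
  part has even sum, and it is determined by its inner part \<open>\<beta>\<close> unless its length is at most 1.
  Hence \<open>S n = 0\<close> for odd \<open>n\<close>, and \<open>S (2 m) = 1 + (\<Sum>j<m. S (2 j))\<close>, which gives
  \<open>S (2 m) = 2 ^ m\<close>.

  For \<open>T (n + 2)\<close>, distinguish whether the outer parts \<open>a\<close> and \<open>b\<close> equal 1.  If both do, removing
  them leaves an arbitrary composition counted by \<open>T n\<close>; if neither does, lowering both by 1
  preserves the relation \<open>a \<noteq> b\<close> and again gives \<open>T n\<close>.  If exactly one of them is 1, the outer
  pair is the asymmetric one, so \<open>\<beta>\<close> is an arbitrary palindrome counted by \<open>S c\<close> with \<open>c < n\<close>, and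
  \<open>\<beta>\<close> determines the other outer part.  Therefore
  \<open>T (n + 2) = 2 T n + 2 (\<Sum>c<n. S c) = 2 T n + 2 (2 ^ \<lceil>n/2\<rceil> - 1)\<close>,
  and with \<open>T 0 = T 1 = 0\<close> this recurrence has the claimed solution.
\<close>

definition even_middle :: "nat list \<Rightarrow> bool" where
  "even_middle \<alpha> \<longleftrightarrow>
     even (length \<alpha>) \<or> odd (length \<alpha>) \<and> even (part \<alpha> ((length \<alpha> + 1) div 2))"

definition almost_palindromic :: "nat \<Rightarrow> nat \<Rightarrow> nat list set" where
  "almost_palindromic k n =
     {\<alpha> \<in> compositions n. card (asymmetric_indices \<alpha>) = k \<and> even_middle \<alpha>}"

lemma pc_plus_1_eq_card: "pc_plus_1 n = card (almost_palindromic 1 n)"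
  by (simp add: pc_plus_1_def almost_palindromic_def even_middle_def)

lemma finite_almost_palindromic: "finite (almost_palindromic k n)"
  by (simp add: almost_palindromic_def finite_compositions)

lemma sum_list_almost_palindromic: "\<alpha> \<in> almost_palindromic k n \<Longrightarrow> sum_list \<alpha> = n"
  by (simp add: almost_palindromic_def compositions_def)

lemma asymmetric_indices_iff:
  "i \<in> asymmetric_indices \<alpha> \<longleftrightarrow>
     1 \<le> i \<and> 2 * i \<le> length \<alpha> \<and> \<alpha> ! (i - 1) \<noteq> \<alpha> ! (length \<alpha> - i)"
  by (auto simp: asymmetric_indices_def part_def)

lemma finite_asymmetric_indices: "finite (asymmetric_indices \<alpha>)"
  by (rule finite_subset[of _ "{..length \<alpha>}"]) (auto simp: asymmetric_indices_iff)

section \<open>Peeling off the outer parts\<close>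

lemma asymmetric_indices_short: "length \<alpha> \<le> 1 \<Longrightarrow> asymmetric_indices \<alpha> = {}"
  by (auto simp: asymmetric_indices_iff)

lemma asymmetric_indices_wrap:
  "asymmetric_indices (a # \<beta> @ [b]) =
     (if a \<noteq> b then {1} else {}) \<union> Suc ` asymmetric_indices \<beta>" (is "?L = ?R")
proof (rule set_eqI)
  fix i
  show "i \<in> ?L \<longleftrightarrow> i \<in> ?R"
  proof (cases "i \<le> 1")
    case True
    then have "i = 0 \<or> i = 1" by auto
    then show ?thesis
      by (auto simp: asymmetric_indices_iff nth_append)
  next
    case False
    then obtain j where j: "i = Suc (Suc j)"
      by (metis One_nat_def not_less_eq_eq old.nat.exhaust zero_le)
    have "i \<in> ?L \<longleftrightarrow> Suc j \<in> asymmetric_indices \<beta>"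
    proof (cases "2 * Suc j \<le> length \<beta>")
      case True
      then have "Suc (length \<beta>) - Suc j = Suc (length \<beta> - Suc j)" by auto
      with True j show ?thesis
        by (auto simp: asymmetric_indices_iff nth_append)
    next
      case False
      with j show ?thesis by (auto simp: asymmetric_indices_iff)
    qed
    also have "\<dots> \<longleftrightarrow> i \<in> ?R"
      using j by auto
    finally show ?thesis .
  qed
qed

lemma card_asymmetric_indices_wrap:
  "card (asymmetric_indices (a # \<beta> @ [b])) =
     card (asymmetric_indices \<beta>) + of_bool (a \<noteq> b)"
proof -
  have "1 \<notin> Suc ` asymmetric_indices \<beta>"
    by (auto simp: asymmetric_indices_iff)
  moreover have "card (Suc ` asymmetric_indices \<beta>) = card (asymmetric_indices \<beta>)"
    by (simp add: card_image)
  ultimately show ?thesis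
    by (simp add: asymmetric_indices_wrap finite_asymmetric_indices)
qed

lemma even_middle_wrap: "even_middle (a # \<beta> @ [b]) \<longleftrightarrow> even_middle \<beta>"
proof (cases "even (length \<beta>)")
  case True
  then show ?thesis by (simp add: even_middle_def)
next
  case False
  then obtain h where "length \<beta> = 2 * h + 1" by (auto elim: oddE)
  then show ?thesis by (simp add: even_middle_def part_def nth_append)
qed

lemma wrap_in_almost_palindromic_iff:
  "a # \<beta> @ [b] \<in> almost_palindromic k n \<longleftrightarrow>
     0 < a \<and> 0 < b \<and>
     (\<exists>j c. \<beta> \<in> almost_palindromic j c \<and> n = a + b + c \<and> k = j + of_bool (a \<noteq> b))"
  by (auto simp: almost_palindromic_def compositions_def even_middle_wrap
      card_asymmetric_indices_wrap)

lemma Nil_in_almost_palindromic_iff: "[] \<in> almost_palindromic k n \<longleftrightarrow> k = 0 \<and> n = 0"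
  by (auto simp: almost_palindromic_def compositions_def even_middle_def
      asymmetric_indices_short)

lemma singleton_in_almost_palindromic_iff:
  "[m] \<in> almost_palindromic k n \<longleftrightarrow> k = 0 \<and> m = n \<and> 0 < n \<and> even n"
  by (auto simp: almost_palindromic_def compositions_def even_middle_def part_def
      asymmetric_indices_short)

lemma list_outer_cases:
  obtains "\<alpha> = []" | m where "\<alpha> = [m]" | a \<beta> b where "\<alpha> = a # \<beta> @ [b]"
  by (metis list.exhaust rev_exhaust)

section \<open>Palindromes\<close>

lemma almost_palindromic_0_odd: "odd n \<Longrightarrow> almost_palindromic 0 n = {}"
proof (induction n rule: less_induct)
  case (less n)
  have "\<alpha> \<notin> almost_palindromic 0 n" for \<alpha>
  proof (cases \<alpha> rule: list_outer_cases)
    case (3 a \<beta> b)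
    show ?thesis
    proof
      assume "\<alpha> \<in> almost_palindromic 0 n"
      with 3 obtain c where "\<beta> \<in> almost_palindromic 0 c" "0 < a" "n = a + a + c"
        by (auto simp: wrap_in_almost_palindromic_iff)
      with less show False by auto
    qed
  qed (use less.prems in \<open>auto simp: Nil_in_almost_palindromic_iff
      singleton_in_almost_palindromic_iff odd_pos\<close>)
  then show ?case by auto
qed

lemma almost_palindromic_0_double:
  "almost_palindromic 0 (2 * m) =
     insert (if m = 0 then [] else [2 * m])
       ((\<lambda>\<beta>. (m - sum_list \<beta> div 2) # \<beta> @ [m - sum_list \<beta> div 2]) `
         (\<Union>j<m. almost_palindromic 0 (2 * j)))" (is "?L = insert ?base (?wrap ` ?I)")
proof (rule set_eqI)
  fix \<alpha>
  show "\<alpha> \<in> ?L \<longleftrightarrow> \<alpha> \<in> insert ?base (?wrap ` ?I)"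
  proof (cases \<alpha> rule: list_outer_cases)
    case (3 a \<beta> b)
    have "\<alpha> \<in> ?wrap ` ?I" if "\<alpha> \<in> ?L"
    proof -
      from that 3 obtain c where c: "\<beta> \<in> almost_palindromic 0 c" "0 < a" "2 * m = a + a + c"
          "a = b"
        by (auto simp: wrap_in_almost_palindromic_iff)
      then have "c = 2 * (m - a)" "m - a < m" by auto
      moreover from this c have "\<alpha> = ?wrap \<beta>"
        by (simp add: 3 sum_list_almost_palindromic)
      ultimately show ?thesis using c by blast
    qed
    moreover have "\<alpha> \<in> ?L" if \<alpha>: "\<alpha> \<in> ?wrap ` ?I"
    proof -
      from \<alpha> obtain \<gamma> j where j: "j < m" "\<gamma> \<in> almost_palindromic 0 (2 * j)" "\<alpha> = ?wrap \<gamma>"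
        by blast
      moreover from j have "sum_list \<gamma> div 2 = j"
        by (simp add: sum_list_almost_palindromic)
      moreover from \<open>j < m\<close> have "2 * m = (m - j) + (m - j) + 2 * j"
        by simp
      ultimately show ?thesis
        by (auto simp: wrap_in_almost_palindromic_iff simp del: One_nat_def)
    qed
    ultimately show ?thesis using 3 by auto
  qed (auto simp: Nil_in_almost_palindromic_iff singleton_in_almost_palindromic_iff)
qed

lemma card_UN_almost_palindromic:
  assumes "finite A" "inj_on f A"
  shows "card (\<Union>j\<in>A. almost_palindromic k (f j)) = (\<Sum>j\<in>A. card (almost_palindromic k (f j)))"
proof (rule card_UN_disjoint)
  show "\<forall>i\<in>A. \<forall>j\<in>A. i \<noteq> j \<longrightarrow> almost_palindromic k (f i) \<inter> almost_palindromic k (f j) = {}"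
    using assms(2) by (metis disjoint_iff inj_onD sum_list_almost_palindromic)
qed (use assms in \<open>auto simp: finite_almost_palindromic\<close>)

lemma card_almost_palindromic_0_double: "card (almost_palindromic 0 (2 * m)) = 2 ^ m"
proof (induction m rule: less_induct)
  case (less m)
  let ?I = "\<Union>j<m. almost_palindromic 0 (2 * j)"
  let ?wrap = "\<lambda>\<beta>. (m - sum_list \<beta> div 2) # \<beta> @ [m - sum_list \<beta> div 2]"
  have "finite ?I"
    by (simp add: finite_almost_palindromic)
  have "card ?I = (\<Sum>j<m. card (almost_palindromic 0 (2 * j)))"
    by (rule card_UN_almost_palindromic) (auto simp: inj_on_def)
  also have "\<dots> = (\<Sum>j<m. 2 ^ j)"
    using less by simp
  finally have "Suc (card ?I) = 2 ^ m"
    by (simp add: lessThan_atLeast0 sum_power2)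
  moreover have "card (?wrap ` ?I) = card ?I"
    by (rule card_image) (auto simp: inj_on_def)
  moreover have "(if m = 0 then [] else [2 * m]) \<notin> ?wrap ` ?I"
    by auto
  ultimately show ?case
    using \<open>finite ?I\<close> by (subst almost_palindromic_0_double) simp
qed

lemma sum_card_almost_palindromic_0:
  "Suc (\<Sum>c<n. card (almost_palindromic 0 c)) = 2 ^ ((n + 1) div 2)"
proof (induction n)
  case (Suc n)
  show ?case
  proof (cases "even n")
    case True
    then obtain m where "n = 2 * m" by (auto elim: evenE)
    with Suc show ?thesis by (simp add: card_almost_palindromic_0_double)
  next
    case False
    with Suc show ?thesis by (auto simp: almost_palindromic_0_odd elim: oddE)
  qed
qed simp

section \<open>Compositions with one asymmetric index\<close>

text \<open>The outer parts are kept apart from the inner list because the recurrence modifies both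
  outer parts at once.\<close>

definition peeled :: "nat \<Rightarrow> nat \<Rightarrow> (nat \<times> nat list \<times> nat) set" where
  "peeled k n = {(a, \<beta>, b). a # \<beta> @ [b] \<in> almost_palindromic k n}"

text \<open>With an asymmetric index the length is at least 2, so that peeling is always possible.\<close>

lemma bij_betw_peeled:
  assumes "k \<noteq> 0"
  shows "bij_betw (\<lambda>(a, \<beta>, b). a # \<beta> @ [b]) (peeled k n) (almost_palindromic k n)"
proof (rule bij_betw_imageI)
  show "(\<lambda>(a, \<beta>, b). a # \<beta> @ [b]) ` peeled k n = almost_palindromic k n"
  proof (intro equalityI subsetI)
    fix \<alpha> assume \<alpha>: "\<alpha> \<in> almost_palindromic k n"
    then show "\<alpha> \<in> (\<lambda>(a, \<beta>, b). a # \<beta> @ [b]) ` peeled k n"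
      by (cases \<alpha> rule: list_outer_cases)
        (use assms in \<open>force simp: Nil_in_almost_palindromic_iff
          singleton_in_almost_palindromic_iff peeled_def\<close>)+
  qed (auto simp: peeled_def)
qed (auto simp: inj_on_def)

lemma card_peeled: "k \<noteq> 0 \<Longrightarrow> card (peeled k n) = card (almost_palindromic k n)"
  using bij_betw_peeled by (rule bij_betw_same_card)

lemma finite_peeled: "k \<noteq> 0 \<Longrightarrow> finite (peeled k n)"
  using bij_betw_peeled finite_almost_palindromic by (metis bij_betw_finite)

text \<open>The four sets correspond to the four answers to the questions whether \<open>a = 1\<close> and whether
  \<open>b = 1\<close>.  In the last two, the remaining outer part is what is left of \<open>n + 2\<close>; it is at least 2
  because the inner sum is smaller than \<open>n\<close>.\<close>

lemma peeled_1_add_2: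
  "peeled 1 (n + 2) =
     (\<lambda>\<beta>. (1, \<beta>, 1)) ` almost_palindromic 1 n \<union>
     (\<lambda>(a, \<beta>, b). (Suc a, \<beta>, Suc b)) ` peeled 1 n \<union>
     (\<lambda>\<beta>. (1, \<beta>, n + 1 - sum_list \<beta>)) ` (\<Union>c<n. almost_palindromic 0 c) \<union>
     (\<lambda>\<beta>. (n + 1 - sum_list \<beta>, \<beta>, 1)) ` (\<Union>c<n. almost_palindromic 0 c)"
  (is "?L = ?A \<union> ?B \<union> ?C \<union> ?D")
proof (intro equalityI subsetI)
  fix x assume "x \<in> ?L"
  then obtain a \<beta> b j c where x: "x = (a, \<beta>, b)" "0 < a" "0 < b"
      and \<beta>: "\<beta> \<in> almost_palindromic j c" "n + 2 = a + b + c" "1 = j + of_bool (a \<noteq> b)"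
    by (auto simp: peeled_def wrap_in_almost_palindromic_iff)
  have s: "sum_list \<beta> = c"
    using \<beta> by (simp add: sum_list_almost_palindromic)
  consider "a = 1" "b = 1" | "a > 1" "b > 1" | "a = 1" "b > 1" | "a > 1" "b = 1"
    using x by linarith
  then show "x \<in> ?A \<union> ?B \<union> ?C \<union> ?D"
  proof cases
    case 1
    with x \<beta> show ?thesis by auto
  next
    case 2
    then obtain a' b' where ab: "a = Suc a'" "b = Suc b'" "0 < a'" "0 < b'"
      by (metis One_nat_def Suc_lessE)
    with \<beta> have "(a', \<beta>, b') \<in> peeled 1 n"
      by (auto simp: peeled_def wrap_in_almost_palindromic_iff)
    then have "x \<in> ?B"
      by (rule rev_image_eqI) (simp add: x ab)
    then show ?thesis by simp
  next
    case 3
    with \<beta> have I: "\<beta> \<in> (\<Union>c<n. almost_palindromic 0 c)" and b: "b = n + 1 - c"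
      by auto
    from I have "x \<in> ?C"
      by (rule rev_image_eqI) (simp add: x s 3 b)
    then show ?thesis by simp
  next
    case 4
    with \<beta> have I: "\<beta> \<in> (\<Union>c<n. almost_palindromic 0 c)" and a: "a = n + 1 - c"
      by auto
    from I have "x \<in> ?D"
      by (rule rev_image_eqI) (simp add: x s 4 a)
    then show ?thesis by simp
  qed
next
  fix x assume "x \<in> ?A \<union> ?B \<union> ?C \<union> ?D"
  then consider "x \<in> ?A" | "x \<in> ?B" | "x \<in> ?C" | "x \<in> ?D"
    by blast
  then show "x \<in> ?L"
    by cases
      (auto simp: peeled_def wrap_in_almost_palindromic_iff sum_list_almost_palindromic)
qed

lemma card_almost_palindromic_1_add_2:
  "card (almost_palindromic 1 (n + 2)) =
     2 * card (almost_palindromic 1 n) + 2 * (\<Sum>c<n. card (almost_palindromic 0 c))"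
proof -
  let ?I = "\<Union>c<n. almost_palindromic 0 c"
  let ?A = "(\<lambda>\<beta>. (1, \<beta>, 1)) ` almost_palindromic 1 n :: (nat \<times> nat list \<times> nat) set"
  let ?B = "(\<lambda>(a, \<beta>, b). (Suc a, \<beta>, Suc b)) ` peeled 1 n"
  let ?C = "(\<lambda>\<beta>. (1, \<beta>, n + 1 - sum_list \<beta>)) ` ?I :: (nat \<times> nat list \<times> nat) set"
  let ?D = "(\<lambda>\<beta>. (n + 1 - sum_list \<beta>, \<beta>, 1)) ` ?I :: (nat \<times> nat list \<times> nat) set"
  have fin: "finite ?A" "finite ?B" "finite ?C" "finite ?D"
    by (simp_all add: finite_almost_palindromic finite_peeled)
  have "card ?I = (\<Sum>c<n. card (almost_palindromic 0 c))"
    using card_UN_almost_palindromic[of "{..<n}" "\<lambda>c. c" 0] by simp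
  moreover have "card ?C = card ?I" "card ?D = card ?I"
    by (rule card_image; auto simp: inj_on_def)+
  moreover have "card ?A = card (almost_palindromic 1 n)"
    by (rule card_image) (auto simp: inj_on_def)
  moreover have "card ?B = card (almost_palindromic 1 n)"
    by (subst card_image) (auto simp: inj_on_def card_peeled)
  moreover have "?A \<inter> ?B = {}" "(?A \<union> ?B) \<inter> ?C = {}" "(?A \<union> ?B \<union> ?C) \<inter> ?D = {}"
    by (auto simp: sum_list_almost_palindromic peeled_def wrap_in_almost_palindromic_iff)
  moreover have "card (almost_palindromic 1 (n + 2)) = card (?A \<union> ?B \<union> ?C \<union> ?D)"
    by (simp only: peeled_1_add_2 flip: card_peeled[OF one_neq_zero])
  ultimately show ?thesis
    using fin by (simp add: card_Un_disjoint)
qed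

text \<open>Two distinct positive outer parts have sum at least 3.\<close>

lemma almost_palindromic_1_less_2:
  assumes "n < 2"
  shows "almost_palindromic 1 n = {}"
proof -
  have "peeled 1 n = {}"
    using assms by (auto simp: peeled_def wrap_in_almost_palindromic_iff)
  then show ?thesis
    using bij_betw_peeled[of 1 n] by (simp add: bij_betw_def)
qed

lemma card_almost_palindromic_1:
  "int (card (almost_palindromic 1 n)) =
     2 + (int ((n + 1) div 2) - 2) * 2 ^ ((n + 1) div 2)"
proof (induction n rule: less_induct)
  case (less n)
  show ?case
  proof (cases "n < 2")
    case True
    then have "n = 0 \<or> n = 1" by auto
    moreover have "card (almost_palindromic 1 n) = 0"
      using True by (simp only: almost_palindromic_1_less_2 card.empty)
    ultimately show ?thesis by auto
  next
    case False
    then obtain m where m: "n = m + 2"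
      by (metis add.commute le_Suc_ex not_less)
    define k where "k = (m + 1) div 2"
    have k: "(n + 1) div 2 = Suc k"
      by (simp add: k_def m)
    have "int (\<Sum>c<m. card (almost_palindromic 0 c)) = 2 ^ k - 1"
      using sum_card_almost_palindromic_0[of m, folded k_def]
      by (metis add_diff_cancel_left' of_nat_Suc of_nat_numeral of_nat_power)
    moreover have "int (card (almost_palindromic 1 m)) = 2 + (int k - 2) * 2 ^ k"
      using less[of m] by (simp add: m k_def)
    ultimately have "int (card (almost_palindromic 1 n)) =
        2 * (2 + (int k - 2) * 2 ^ k) + 2 * (2 ^ k - 1)"
      by (simp only: m card_almost_palindromic_1_add_2 of_nat_add of_nat_mult of_nat_numeral)
    then show ?thesis
      unfolding k by (simp add: algebra_simps)
  qed
qed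

theorem mainTheorem12:
  fixes n :: nat
  shows "int (pc_plus_1 n) = 2 + (\<lceil>real n / 2\<rceil> - 2) * 2 ^ nat \<lceil>real n / 2\<rceil>"
proof -
  have "\<lceil>real n / 2\<rceil> = int ((n + 1) div 2)"
  proof (cases "even n")
    case True
    then show ?thesis by (auto elim: evenE)
  next
    case False
    then obtain m where "n = 2 * m + 1" by (auto elim: oddE)
    then show ?thesis by (intro ceiling_unique) (auto simp: field_simps)
  qed
  then show ?thesis
    by (simp add: pc_plus_1_eq_card card_almost_palindromic_1[simplified])
qed

end
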